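(* Let $\mathbf{k}$ be a commutative unital ring, $n\ge 1$, and $\lambda\in\mathbf{k}\setminus\{0\}$. Let $E$ be the identity matrix, $\Delta_\lambda(N)=N\otimes(-\lambda E)$ for $N\in M_n(\mathbf{k})$, and define, writing $\Delta_\lambda(N)=\sum_{(N)}N_{(1)}\otimes N_{(2)}$, $$M\rhd_\lambda N:=\sum_{(N)}N_{(1)}MN_{(2)}\qquad (M,N\in M_n(\mathbf{k})).$$ Then $(M_n(\mathbf{k}),\rhd_\lambda)$ is a (left) pre-Lie algebra, and so $(M_n(\mathbf{k}),[-,-]_\lambda)$ is a Lie algebra, where $$[M,N]_\lambda:=\lambda(MN-NM).$$
   Context: A (left) pre-Lie algebra is a $\mathbf{k}$-module $A$ with a bilinear operation $\rhd$ such that $(a\rhd b)\rhd c-a\rhd(b\rhd c)=(b\rhd a)\rhd c-b\rhd(a\rhd c)$ for all $a,b,c\in A$. The bracket $[-,-]_\lambda$ is the one obtained from $\rhd_\lambda$ by $[M,N]_\lambda=M\rhd_\lambda N-N\rhd_\lambda M$. *)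

theory Defs
  imports "HOL-Analysis.Analysis" "HOL-Library.Poly_Mapping"
begin

locale bilinear_operation = module scale
  for scale :: "'a::comm_ring_1 \<Rightarrow> 'b::ab_group_add \<Rightarrow> 'b" +
  fixes op :: "'b \<Rightarrow> 'b \<Rightarrow> 'b"
  assumes hom_right: "\<And>x. module_hom scale scale (\<lambda>y. op x y)"
    and hom_left: "\<And>y. module_hom scale scale (\<lambda>x. op x y)"

locale pre_lie_algebra = bilinear_operation scale op
  for scale :: "'a::comm_ring_1 \<Rightarrow> 'b::ab_group_add \<Rightarrow> 'b" and op +
  assumes left_symmetric:
    "op (op a b) c - op a (op b c) = op (op b a) c - op b (op a c)"

locale lie_algebra = bilinear_operation scale bracket
  for scale :: "'a::comm_ring_1 \<Rightarrow> 'b::ab_group_add \<Rightarrow> 'b" and bracket +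
  assumes alternating: "bracket x x = 0"
    and jacobi: "bracket x (bracket y z) + bracket y (bracket z x) + bracket z (bracket x y) = 0"

definition commutator :: "('b \<Rightarrow> 'b \<Rightarrow> 'b) \<Rightarrow> 'b \<Rightarrow> 'b \<Rightarrow> 'b::ab_group_add" where
  "commutator op x y = op x y - op y x"

text \<open>The library's \<open>scaleR\<close> covers only real scalars, and its \<open>*s\<close> on
  \<open>'a^'n^'n\<close> would take scalars from the type of rows.\<close>

definition matrix_scale :: "'a::comm_ring_1 \<Rightarrow> 'a^'n^'n \<Rightarrow> 'a^'n^'n"  (infixr \<open>*\<^sub>m\<close> 75)
  where "c *\<^sub>m A = (\<chi> i j. c * A $ i $ j)"

lemma matrix_scale_nth [simp]: "(c *\<^sub>m A) $ i $ j = c * A $ i $ j"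
  by (simp add: matrix_scale_def)

lemma module_matrix_scale: "module ((*\<^sub>m) :: 'a::comm_ring_1 \<Rightarrow> 'a^'n^'n \<Rightarrow> 'a^'n^'n)"
  by standard (simp_all add: vec_eq_iff algebra_simps)

interpretation matrix: module "(*\<^sub>m) :: 'a::comm_ring_1 \<Rightarrow> 'a^'n^'n \<Rightarrow> 'a^'n^'n"
  by (rule module_matrix_scale)

lemma matrix_scale_mult_left: "(c *\<^sub>m A) ** B = c *\<^sub>m (A ** B)"
  by (simp add: vec_eq_iff matrix_matrix_mult_def sum_distrib_left mult_ac)

lemma matrix_scale_mult_right: "A ** (c *\<^sub>m B) = c *\<^sub>m (A ** B)"
  by (simp add: vec_eq_iff matrix_matrix_mult_def sum_distrib_left mult_ac)

lemma matrix_mult_add_left: "(A + B) ** C = A ** C + B ** (C :: 'a::comm_ring_1^'n^'n)"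
  by (simp add: vec_eq_iff matrix_matrix_mult_def sum.distrib algebra_simps)

lemma matrix_mult_add_right: "A ** (B + C) = A ** B + A ** (C :: 'a::comm_ring_1^'n^'n)"
  by (simp add: vec_eq_iff matrix_matrix_mult_def sum.distrib algebra_simps)

text \<open>The tensor product over the coefficient ring is the free abelian group on pairs of
  matrices modulo the subgroup generated by the usual relations.\<close>

inductive_set tensor_null :: "((('a::comm_ring_1^'n^'n) \<times> ('a^'n^'n)) \<Rightarrow>\<^sub>0 int) set" where
  add_left: "frag_of (X + X', Y) - frag_of (X, Y) - frag_of (X', Y) \<in> tensor_null"
| add_right: "frag_of (X, Y + Y') - frag_of (X, Y) - frag_of (X, Y') \<in> tensor_null"
| balanced: "frag_of (c *\<^sub>m X, Y) - frag_of (X, c *\<^sub>m Y) \<in> tensor_null"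
| zero: "0 \<in> tensor_null"
| diff: "p \<in> tensor_null \<Longrightarrow> q \<in> tensor_null \<Longrightarrow> p - q \<in> tensor_null"

lemma tensor_null_uminus: "p \<in> tensor_null \<Longrightarrow> - p \<in> tensor_null"
  using tensor_null.diff[OF tensor_null.zero] by simp

lemma tensor_null_add: "p \<in> tensor_null \<Longrightarrow> q \<in> tensor_null \<Longrightarrow> p + q \<in> tensor_null"
  using tensor_null.diff[OF _ tensor_null_uminus] by fastforce

lemma diff_diff_rearrange: "(a - b) - (c - d) = (a - c) - (b - (d :: 'a::ab_group_add))"
  by (simp add: algebra_simps)

definition tensor_eq ::
  "((('a::comm_ring_1^'n^'n) \<times> ('a^'n^'n)) \<Rightarrow>\<^sub>0 int) \<Rightarrow> ((('a^'n^'n) \<times> ('a^'n^'n)) \<Rightarrow>\<^sub>0 int) \<Rightarrow> bool"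
  where "tensor_eq p q \<longleftrightarrow> p - q \<in> tensor_null"

lemma equivp_tensor_eq: "equivp tensor_eq"
proof (rule equivpI)
  show "reflp tensor_eq"
    by (simp add: reflp_def tensor_eq_def tensor_null.zero)
  show "symp tensor_eq"
    unfolding symp_def tensor_eq_def using tensor_null_uminus by (metis minus_diff_eq)
  show "transp tensor_eq"
    unfolding transp_def tensor_eq_def by (auto dest: tensor_null_add)
qed

quotient_type (overloaded) ('a, 'n) matrix_tensor =
  "(('a::comm_ring_1^'n::finite^'n) \<times> ('a^'n^'n)) \<Rightarrow>\<^sub>0 int" / tensor_eq
  by (rule equivp_tensor_eq)

instantiation matrix_tensor :: (comm_ring_1, finite) ab_group_add
begin

lift_definition zero_matrix_tensor :: "('a, 'b) matrix_tensor" is 0 .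

lift_definition plus_matrix_tensor ::
  "('a, 'b) matrix_tensor \<Rightarrow> ('a, 'b) matrix_tensor \<Rightarrow> ('a, 'b) matrix_tensor" is "(+)"
  unfolding tensor_eq_def add_diff_add by (rule tensor_null_add)

lift_definition uminus_matrix_tensor :: "('a, 'b) matrix_tensor \<Rightarrow> ('a, 'b) matrix_tensor"
  is uminus
  unfolding tensor_eq_def minus_diff_minus by (rule tensor_null_uminus)

lift_definition minus_matrix_tensor ::
  "('a, 'b) matrix_tensor \<Rightarrow> ('a, 'b) matrix_tensor \<Rightarrow> ('a, 'b) matrix_tensor" is "(-)"
  unfolding tensor_eq_def diff_diff_rearrange by (rule tensor_null.diff)

instance
proof
  fix a b c :: "('a, 'b) matrix_tensor"
  show "a + b + c = a + (b + c)"
    by transfer (simp add: tensor_eq_def tensor_null.zero add.assoc)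
  show "a + b = b + a"
    by transfer (simp add: tensor_eq_def tensor_null.zero add.commute)
  show "0 + a = a"
    by transfer (simp add: tensor_eq_def tensor_null.zero)
  show "- a + a = 0"
    by transfer (simp add: tensor_eq_def tensor_null.zero)
  show "a - b = a + - b"
    by transfer (simp add: tensor_eq_def tensor_null.zero)
qed

end

lift_definition tensor :: "'a::comm_ring_1^'n^'n \<Rightarrow> 'a^'n^'n \<Rightarrow> ('a, 'n::finite) matrix_tensor"
  (infixl \<open>\<otimes>\<^sub>m\<close> 70) is "\<lambda>X Y. frag_of (X, Y)" .

lemma tensor_add_left: "(X + X') \<otimes>\<^sub>m Y = X \<otimes>\<^sub>m Y + X' \<otimes>\<^sub>m Y"
  by transfer (use tensor_null.add_left in \<open>simp add: tensor_eq_def diff_diff_eq\<close>)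

lemma tensor_add_right: "X \<otimes>\<^sub>m (Y + Y') = X \<otimes>\<^sub>m Y + X \<otimes>\<^sub>m Y'"
  by transfer (use tensor_null.add_right in \<open>simp add: tensor_eq_def diff_diff_eq\<close>)

lemma tensor_balanced: "(c *\<^sub>m X) \<otimes>\<^sub>m Y = X \<otimes>\<^sub>m (c *\<^sub>m Y)"
  by transfer (simp add: tensor_eq_def tensor_null.balanced)

definition frag_sandwich ::
  "'a::comm_ring_1^'n^'n \<Rightarrow> ((('a^'n^'n) \<times> ('a^'n^'n)) \<Rightarrow>\<^sub>0 int) \<Rightarrow> 'a^'n^'n" where
  "frag_sandwich M p =
     (\<Sum>(X, Y)\<in>Poly_Mapping.keys p. of_int (Poly_Mapping.lookup p (X, Y)) *\<^sub>m (X ** M ** Y))"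

lemma frag_sandwich_superset:
  assumes "finite S" "Poly_Mapping.keys p \<subseteq> S"
  shows "frag_sandwich M p =
    (\<Sum>(X, Y)\<in>S. of_int (Poly_Mapping.lookup p (X, Y)) *\<^sub>m (X ** M ** Y))"
  unfolding frag_sandwich_def using assms
  by (intro sum.mono_neutral_left) (auto simp: in_keys_iff)

lemma frag_sandwich_diff: "frag_sandwich M (p - q) = frag_sandwich M p - frag_sandwich M q"
proof -
  let ?S = "Poly_Mapping.keys p \<union> Poly_Mapping.keys q \<union> Poly_Mapping.keys (p - q)"
  have "frag_sandwich M r =
      (\<Sum>(X, Y)\<in>?S. of_int (Poly_Mapping.lookup r (X, Y)) *\<^sub>m (X ** M ** Y))"
    if "r \<in> {p, q, p - q}" for r
    using that by (intro frag_sandwich_superset) auto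
  then show ?thesis
    by (simp add: sum_subtractf[symmetric] lookup_minus case_prod_unfold
        matrix.scale_left_diff_distrib)
qed

lemma frag_sandwich_of: "frag_sandwich M (frag_of (X, Y)) = X ** M ** Y"
  by (simp add: frag_sandwich_def)

lemma frag_sandwich_null: "p \<in> tensor_null \<Longrightarrow> frag_sandwich M p = 0"
  by (induction rule: tensor_null.induct)
    (simp_all add: frag_sandwich_diff frag_sandwich_of matrix_mult_add_left matrix_mult_add_right
      matrix_scale_mult_left matrix_scale_mult_right, simp add: frag_sandwich_def)

text \<open>The linear map sending \<open>X \<otimes>\<^sub>m Y\<close> to \<open>X ** M ** Y\<close>. In Sweedler notation, its value at
  \<open>\<Delta> N\<close> is the sum of all \<open>N\<^sub>(\<^sub>1\<^sub>) ** M ** N\<^sub>(\<^sub>2\<^sub>)\<close>; see \<open>sandwich_sum\<close> below.\<close>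

lift_definition sandwich :: "'a::comm_ring_1^'n^'n \<Rightarrow> ('a, 'n::finite) matrix_tensor \<Rightarrow> 'a^'n^'n"
  is frag_sandwich
  using frag_sandwich_null frag_sandwich_diff unfolding tensor_eq_def
  by (metis eq_iff_diff_eq_0)

lemma sandwich_tensor: "sandwich M (X \<otimes>\<^sub>m Y) = X ** M ** Y"
  by transfer (rule frag_sandwich_of)

lemma sandwich_diff: "sandwich M (s - t) = sandwich M s - sandwich M t"
  by transfer (rule frag_sandwich_diff)

lemma sandwich_add: "sandwich M (s + t) = sandwich M s + sandwich M t"
  using sandwich_diff[of M "s + t" t] by (simp add: algebra_simps)

lemma sandwich_sum: "sandwich M (\<Sum>i\<in>I. X i \<otimes>\<^sub>m Y i) = (\<Sum>i\<in>I. X i ** M ** Y i)"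
  using sandwich_diff[of M 0 0]
  by (induction I rule: infinite_finite_induct) (simp_all add: sandwich_add sandwich_tensor)

definition coproduct_op ::
  "('a::comm_ring_1^'n^'n \<Rightarrow> ('a, 'n::finite) matrix_tensor) \<Rightarrow> 'a^'n^'n \<Rightarrow> 'a^'n^'n \<Rightarrow> 'a^'n^'n"
  where "coproduct_op \<Delta> M N = sandwich M (\<Delta> N)"

definition Delta :: "'a::comm_ring_1 \<Rightarrow> 'a^'n^'n \<Rightarrow> ('a, 'n::finite) matrix_tensor" where
  "Delta c N = N \<otimes>\<^sub>m (- (c *\<^sub>m mat 1))"

definition matrix_pre_lie :: "'a::comm_ring_1 \<Rightarrow> 'a^'n::finite^'n \<Rightarrow> 'a^'n^'n \<Rightarrow> 'a^'n^'n" where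
  "matrix_pre_lie c = coproduct_op (Delta c)"

definition matrix_bracket :: "'a::comm_ring_1 \<Rightarrow> 'a^'n::finite^'n \<Rightarrow> 'a^'n^'n \<Rightarrow> 'a^'n^'n" where
  "matrix_bracket c = commutator (matrix_pre_lie c)"

end

theory Submission
  imports Defs
begin

text \<open>Contracting \<open>\<Delta> N = N \<otimes>\<^sub>m (- l E)\<close> around \<open>M\<close> gives \<open>- l N M\<close>, a scalar multiple of the
  opposite matrix product. It is therefore bilinear and associative, so both sides of the
  left-symmetry identity vanish. For any pre-Lie product, the Jacobi identity of the commutator is
  the sum of three instances of left symmetry.\<close>

context bilinear_operation
begin

lemma op_add_right: "op x (y + z) = op x y + op x z"
  by (rule module_hom.add[OF hom_right])

lemma op_add_left: "op (x + y) z = op x z + op y z"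
  by (rule module_hom.add[OF hom_left])

lemma op_diff_right: "op x (y - z) = op x y - op x z"
  by (rule module_hom.diff[OF hom_right])

lemma op_diff_left: "op (x - y) z = op x z - op y z"
  by (rule module_hom.diff[OF hom_left])

lemma op_scale_right: "op x (scale c y) = scale c (op x y)"
  by (rule module_hom.scale[OF hom_right])

lemma op_scale_left: "op (scale c x) y = scale c (op x y)"
  by (rule module_hom.scale[OF hom_left])

lemma bilinear_operation_commutator: "bilinear_operation scale (commutator op)"
  by unfold_locales
    (simp_all add: commutator_def op_add_left op_add_right op_scale_left op_scale_right
      scale_right_diff_distrib scale_right_distrib scale_left_distrib)

lemma pre_lie_algebra_if_assoc:
  assumes "\<And>a b c. op (op a b) c = op a (op b c)"
  shows "pre_lie_algebra scale op"
  by unfold_locales (simp add: assms)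

end

lemma (in pre_lie_algebra) lie_algebra_commutator: "lie_algebra scale (commutator op)"
proof -
  interpret commutator: bilinear_operation scale "commutator op"
    by (rule bilinear_operation_commutator)
  show ?thesis
  proof
    show "commutator op x x = 0" for x
      by (simp add: commutator_def)
    \<comment> \<open>Put in the form "difference equals zero", left symmetry can rewrite whole
      blocks of the sum below.\<close>
    have left_symmetric_0:
      "op (op a b) c - op a (op b c) - (op (op b a) c - op b (op a c)) = 0" for a b c
      using left_symmetric[of a b c] by simp
    show "commutator op x (commutator op y z) + commutator op y (commutator op z x)
        + commutator op z (commutator op x y) = 0" (is "?J = 0") for x y z
    proof -
      \<comment> \<open>The twelve iterated products in \<open>?J\<close> regroup, up to sign, into
        left symmetry at the three cyclic rotations of \<open>(x, y, z)\<close>.\<close>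
      have "?J = - (op (op x y) z - op x (op y z) - (op (op y x) z - op y (op x z)))
          - (op (op y z) x - op y (op z x) - (op (op z y) x - op z (op y x)))
          - (op (op z x) y - op z (op x y) - (op (op x z) y - op x (op z y)))"
        by (simp add: commutator_def op_diff_left op_diff_right)
      then show ?thesis
        by (simp only: left_symmetric_0) simp
    qed
  qed
qed

lemma matrix_pre_lie_eq: "matrix_pre_lie l M N = (- l) *\<^sub>m (N ** M)"
proof -
  \<comment> \<open>The sign moves into the scalar so that the whole coefficient can be pulled out
    of the product.\<close>
  have "- (l *\<^sub>m mat 1) = (- l) *\<^sub>m (mat 1 :: 'a^'b^'b)"
    by simp
  then show ?thesis
    by (simp add: matrix_pre_lie_def coproduct_op_def Delta_def sandwich_tensor
        matrix_scale_mult_right del: matrix.scale_minus_left)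
qed

lemma bilinear_operation_matrix_pre_lie: "bilinear_operation (*\<^sub>m) (matrix_pre_lie l)"
  by unfold_locales
    (simp_all add: matrix_pre_lie_eq matrix_mult_add_left matrix_mult_add_right
      matrix_scale_mult_left matrix_scale_mult_right matrix.scale_right_distrib mult.commute)

text \<open>Both sides are \<open>(l * l) *\<^sub>m (C ** B ** A)\<close>: each application reverses
  the factors and contributes one \<open>- l\<close>.\<close>

lemma matrix_pre_lie_assoc:
  "matrix_pre_lie l (matrix_pre_lie l A B) C = matrix_pre_lie l A (matrix_pre_lie l B C)"
  by (simp add: matrix_pre_lie_eq matrix_scale_mult_left matrix_scale_mult_right matrix_mul_assoc
      del: matrix.scale_minus_left)

theorem theorem3p8:
  fixes l :: "'k::comm_ring_1"
  assumes "l \<noteq> 0"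
  shows "pre_lie_algebra (*\<^sub>m) (matrix_pre_lie l :: 'k^'n::finite^'n \<Rightarrow> _)
    \<and> lie_algebra (*\<^sub>m) (matrix_bracket l :: 'k^'n^'n \<Rightarrow> _)
    \<and> (\<forall>M N :: 'k^'n^'n. matrix_bracket l M N = l *\<^sub>m (M ** N - N ** M))"
proof (intro conjI allI)
  show pre_lie: "pre_lie_algebra (*\<^sub>m) (matrix_pre_lie l :: 'k^'n^'n \<Rightarrow> _)"
    by (rule bilinear_operation.pre_lie_algebra_if_assoc[OF bilinear_operation_matrix_pre_lie
          matrix_pre_lie_assoc])
  show "lie_algebra (*\<^sub>m) (matrix_bracket l :: 'k^'n^'n \<Rightarrow> _)"
    unfolding matrix_bracket_def by (rule pre_lie_algebra.lie_algebra_commutator[OF pre_lie])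
  \<comment> \<open>Order reversal and the sign of \<open>- l\<close> cancel, which leaves the usual
    commutator scaled by \<open>l\<close>.\<close>
  show "matrix_bracket l M N = l *\<^sub>m (M ** N - N ** M)" for M N :: "'k^'n^'n"
    by (simp add: matrix_bracket_def commutator_def matrix_pre_lie_eq
        matrix.scale_right_diff_distrib)
qed

end
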